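(* Let $\gamma\in\mathbb{R}$, let $\psi\in\mathcal{O}_\gamma(\mathbb{R})$, $f\in\mathcal{O}'_\gamma(\mathbb{R})$, $N=[[\gamma]]-1$, and let $\mu_\alpha=\langle f,x^\alpha\rangle$ be the moment sequence of $f$. Then for every fixed $b\in\mathbb{R}$, $$\sqrt{a}\,\Big\langle f(ax),\psi\Big(x-\frac{b}{a}\Big)\Big\rangle=\sum_{\alpha=0}^{N}\frac{\mu_\alpha\, D^\alpha\psi(-b/a)}{\alpha!\,a^{\alpha+1/2}}+O\Big(\frac{1}{a^{N+1/2}}\Big)\qquad\text{as } a\to\infty.$$
   Context: For $\gamma\in\mathbb{R}$, $\mathcal{O}_\gamma(\mathbb{R})$ is the space of smooth functions $\psi$ on $\mathbb{R}$ such that $D^\alpha\psi(x)=O(|x|^\gamma)$ as $|x|\to\infty$ for every $\alpha\in\mathbb{N}=\{0,1,2,\dots\}$, topologized by the seminorms $\|\psi\|_{\alpha,\gamma}=\sup\{\rho_\gamma(|x|)\,|D^\alpha\psi(x)|:x\in\mathbb{R}\}$, $\alpha\in\mathbb{N}$, where $\rho_\gamma(|x|)=1$ for $0\le|x|\le 1$ and $\rho_\gamma(|x|)=|x|^{-\gamma}$ for $|x|>1$. $\mathcal{O}'_\gamma(\mathbb{R})$ is its dual. $[[\gamma]]$ is the integer part (greatest integer $\le\gamma$); a sum with $N<0$ is empty. $D^\alpha$ is the $\alpha$-th derivative. $\langle\cdot,\cdot\rangle$ is the (bilinear) duality pairing in the variable $x$, and for $a>0$ the dilated distribution $f(ax)$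 is defined by $\langle f(ax),\phi(x)\rangle=\frac1a\langle f(x),\phi(x/a)\rangle$. The left-hand side is the continuous wavelet transform $(W_\psi f)(a,b)$ of $f$ with respect to $\psi$, formally $\frac{1}{\sqrt a}\int f(x)\,\psi\big(\frac{x-b}{a}\big)\,dx$. *)

theory Defs
  imports "HOL-Analysis.Analysis" "HOL-Library.Landau_Symbols"
begin

text \<open>Test functions are complex valued functions of a real variable. \<open>Deriv k \<psi>\<close> is the
  \<open>k\<close>-th derivative; it is meaningful when \<open>\<psi>\<close> is smooth.\<close>

definition Deriv :: "nat \<Rightarrow> (real \<Rightarrow> complex) \<Rightarrow> real \<Rightarrow> complex" where
  "Deriv k \<psi> = ((\<lambda>g x. vector_derivative g (at x)) ^^ k) \<psi>"

definition smooth :: "(real \<Rightarrow> complex) \<Rightarrow> bool" where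
  "smooth \<psi> \<longleftrightarrow> (\<forall>k x. Deriv k \<psi> differentiable at x)"

definition O_space :: "real \<Rightarrow> (real \<Rightarrow> complex) set" where
  "O_space \<gamma> = {\<psi>. smooth \<psi> \<and>
     (\<forall>\<alpha>. (\<lambda>x. cmod (Deriv \<alpha> \<psi> x)) \<in> O[at_infinity](\<lambda>x. \<bar>x\<bar> powr \<gamma>))}"

definition rho :: "real \<Rightarrow> real \<Rightarrow> real" where
  "rho \<gamma> r = (if r \<le> 1 then 1 else r powr (- \<gamma>))"

text \<open>On \<open>O_space \<gamma>\<close> the supremum is that of a bounded set.\<close>

definition O_seminorm :: "real \<Rightarrow> nat \<Rightarrow> (real \<Rightarrow> complex) \<Rightarrow> real" where
  "O_seminorm \<gamma> \<alpha> \<psi> = (SUP x. rho \<gamma> \<bar>x\<bar> * cmod (Deriv \<alpha> \<psi> x))"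

text \<open>The locally convex topology of the seminorms: the open seminorm balls form a subbase.\<close>

definition O_topology :: "real \<Rightarrow> (real \<Rightarrow> complex) topology" where
  "O_topology \<gamma> = topology_generated_by
     {{\<eta> \<in> O_space \<gamma>. O_seminorm \<gamma> \<alpha> (\<lambda>x. \<eta> x - \<phi> x) < r} | \<phi> \<alpha> r. \<phi> \<in> O_space \<gamma> \<and> 0 < r}"

text \<open>Functionals are total functions in HOL; only their values on \<open>O_space \<gamma>\<close> are constrained.\<close>

definition O_dual :: "real \<Rightarrow> ((real \<Rightarrow> complex) \<Rightarrow> complex) set" where
  "O_dual \<gamma> = {f.
     (\<forall>\<phi>\<in>O_space \<gamma>. \<forall>\<eta>\<in>O_space \<gamma>. f (\<lambda>x. \<phi> x + \<eta> x) = f \<phi> + f \<eta>) \<and>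
     (\<forall>c. \<forall>\<phi>\<in>O_space \<gamma>. f (\<lambda>x. c * \<phi> x) = c * f \<phi>) \<and>
     continuous_map (O_topology \<gamma>) euclidean f}"

text \<open>The pairing of \<open>f\<close> with \<open>\<phi>\<close> is the application \<open>f \<phi>\<close>, which is bilinear (no conjugation).
  \<open>dilate a f\<close> is the distribution \<open>f(ax)\<close>, for \<open>a > 0\<close>.\<close>

definition dilate :: "real \<Rightarrow> ((real \<Rightarrow> complex) \<Rightarrow> complex) \<Rightarrow> (real \<Rightarrow> complex) \<Rightarrow> complex" where
  "dilate a f \<phi> = complex_of_real (1 / a) * f (\<lambda>x. \<phi> (x / a))"

text \<open>For \<open>f \<in> O_dual \<gamma>\<close> this is meaningful when \<open>\<alpha> \<le> \<gamma>\<close>, so that the monomial lies in \<open>O_space \<gamma>\<close>.\<close>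

definition moment :: "((real \<Rightarrow> complex) \<Rightarrow> complex) \<Rightarrow> nat \<Rightarrow> complex" where
  "moment f \<alpha> = f (\<lambda>x. complex_of_real x ^ \<alpha>)"

end

theory Submission
  imports Defs
begin

text \<open>
  Unfolding the dilation, \<open>\<langle>f(ax), \<psi>(x - b/a)\<rangle> = \<langle>f(x), \<psi>((x - b)/a)\<rangle> / a\<close>. For large \<open>a\<close> the test
  function \<open>x \<mapsto> \<psi>((x - b)/a)\<close> varies slowly, so it is replaced by its Taylor polynomial around
  \<open>x = 0\<close>, that is, by the expansion of \<open>\<psi>\<close> around \<open>s = -b/a\<close> evaluated at \<open>t = x/a\<close>. With
  \<open>n = \<lfloor>\<gamma>\<rfloor> = N + 1\<close> terms this polynomial has degree less than \<open>\<gamma>\<close>, so it still lies in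
  \<open>O_space \<gamma>\<close>, and \<open>f\<close> maps it to the sum over the moments. It remains to see that \<open>f\<close> is small on the
  remainder.

  A continuous linear functional is dominated by finitely many of the weighted seminorms
  (\<open>O_dual_bounded\<close>), so the seminorms of the remainder must be estimated uniformly in \<open>a\<close>. Near the
  origin the remainder is \<open>O(\<bar>t\<bar>\<^sup>n)\<close> by Taylor's theorem (\<open>taylor_remainder_local\<close>); far out it only
  satisfies the growth condition \<open>O(\<bar>t\<bar> powr \<gamma>)\<close> of the space (\<open>taylor_remainder_global\<close>), and there
  the constants do not depend on the base point \<open>s\<close> because the weight changes by a bounded factor
  under bounded shifts. Inserting \<open>t = x/a\<close>, both regimes give a factor \<open>a powr (- \<lfloor>\<gamma>\<rfloor>)\<close> after
  multiplication with the weight in \<open>x\<close> (\<open>dilation_decay\<close>): near the origin because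
  \<open>n \<le> \<gamma>\<close>, far out because \<open>\<lfloor>\<gamma>\<rfloor> \<le> \<gamma>\<close>. Differentiating \<open>k\<close> times turns the remainder into the one
  of order \<open>n - k\<close> for \<open>D\<^sup>k \<psi>\<close>, with an extra factor \<open>a\<^sup>-\<^sup>k\<close> that makes up for the lower order.
  Together with the prefactor \<open>sqrt a / a\<close> the error is \<open>O(a powr (- \<lfloor>\<gamma>\<rfloor> - 1/2))\<close>, and
  \<open>\<lfloor>\<gamma>\<rfloor> = N + 1\<close>. For \<open>\<gamma> < 0\<close> there are no terms and the same argument runs with \<open>n = 0\<close>.
\<close>

section \<open>Iterated derivatives\<close>

lemma Deriv_0: "Deriv 0 \<phi> = \<phi>"
  by (simp add: Deriv_def)

lemma Deriv_Suc: "Deriv (Suc k) \<phi> x = vector_derivative (Deriv k \<phi>) (at x)"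
  by (simp add: Deriv_def)

lemma smooth_has_vector_derivative:
  assumes "smooth \<phi>"
  shows "(Deriv k \<phi> has_vector_derivative Deriv (Suc k) \<phi> x) (at x)"
  using assms by (simp add: smooth_def Deriv_Suc vector_derivative_works)

text \<open>The derivatives of all concrete functions below are computed by guessing the whole sequence
  and applying the following uniqueness principle.\<close>

lemma Deriv_eqI:
  assumes "D 0 = \<phi>"
    and "\<And>k x. (D k has_vector_derivative D (Suc k) x) (at x)"
  shows "Deriv k \<phi> = D k"
proof (induction k)
  case 0
  then show ?case using assms by (simp add: Deriv_0)
next
  case (Suc k)
  show ?case
    by (rule ext) (use Suc assms(2)[of k] in \<open>simp add: Deriv_Suc vector_derivative_at\<close>)
qed

lemma smoothI:
  assumes "D 0 = \<phi>"
    and "\<And>k x. (D k has_vector_derivative D (Suc k) x) (at x)"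
  shows "smooth \<phi>"
  unfolding smooth_def
  using assms(2) by (auto simp: Deriv_eqI[of D, OF assms] intro: differentiableI_vector)

section \<open>The weight and the test space\<close>

lemma rho_altdef: "rho \<gamma> r = max 1 r powr (- \<gamma>)"
  by (auto simp: rho_def max_def)

lemma rho_pos: "0 < rho \<gamma> r"
  by (auto simp: rho_altdef)

text \<open>Peetre's inequality: since \<open>max 1 \<bar>t\<bar>\<close> and \<open>max 1 \<bar>s + t\<bar>\<close> differ at most by the factor \<open>1 + B\<close>
  in either direction, bounds that involve the weight survive bounded translations.\<close>

lemma rho_translate:
  assumes "\<bar>s\<bar> \<le> B"
  shows "rho \<gamma> \<bar>t\<bar> \<le> (1 + B) powr \<bar>\<gamma>\<bar> * rho \<gamma> \<bar>s + t\<bar>"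
proof -
  define u where "u = max 1 \<bar>t\<bar>"
  define v where "v = max 1 \<bar>s + t\<bar>"
  have B: "0 \<le> B" using assms by linarith
  have uv: "1 \<le> u" "1 \<le> v" by (auto simp: u_def v_def)
  have "B * 1 \<le> B * u" "B * 1 \<le> B * v" using B uv by (auto intro: mult_left_mono simp del: mult_1_right)
  moreover have "u \<le> v + B" "v \<le> u + B" using assms by (auto simp: u_def v_def)
  ultimately have le: "u \<le> (1 + B) * v" "v \<le> (1 + B) * u"
    by (auto simp: algebra_simps)
  have "u powr (- \<gamma>) \<le> (1 + B) powr \<bar>\<gamma>\<bar> * v powr (- \<gamma>)"
  proof (cases "\<gamma> \<ge> 0")
    case True
    have "v powr \<gamma> \<le> ((1 + B) * u) powr \<gamma>"
      using le uv True by (intro powr_mono2) auto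
    then show ?thesis
      using True uv B by (simp add: powr_mult powr_minus divide_simps mult.commute)
  next
    case False
    have "u powr (- \<gamma>) \<le> ((1 + B) * v) powr (- \<gamma>)"
      using le uv False by (intro powr_mono2) auto
    then show ?thesis
      using False uv B by (simp add: powr_mult)
  qed
  then show ?thesis by (simp add: rho_altdef u_def v_def)
qed

lemma rho_power_le_1:
  assumes "real j \<le> \<gamma>"
  shows "rho \<gamma> \<bar>x\<bar> * \<bar>x\<bar> ^ j \<le> 1"
proof (cases "\<bar>x\<bar> \<le> 1")
  case True
  then show ?thesis by (simp add: rho_def power_le_one)
next
  case False
  then have "rho \<gamma> \<bar>x\<bar> * \<bar>x\<bar> ^ j = \<bar>x\<bar> powr (real j - \<gamma>)"
    by (simp add: rho_def powr_diff powr_minus powr_realpow field_simps)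
  also have "\<dots> \<le> \<bar>x\<bar> powr 0"
    using False assms by (intro powr_mono) auto
  also have "\<dots> = 1" using False by auto
  finally show ?thesis .
qed

text \<open>The growth condition at infinity is the same as finiteness of the seminorms, because the
  derivatives are bounded on compact sets.\<close>

lemma O_space_iff:
  "\<phi> \<in> O_space \<gamma> \<longleftrightarrow>
     smooth \<phi> \<and> (\<forall>k. \<exists>M. \<forall>x. rho \<gamma> \<bar>x\<bar> * cmod (Deriv k \<phi> x) \<le> M)"
proof (intro iffI conjI allI)
  assume \<phi>: "\<phi> \<in> O_space \<gamma>"
  then show sm: "smooth \<phi>" by (simp add: O_space_def)
  fix k
  from \<phi> have "(\<lambda>x. cmod (Deriv k \<phi> x)) \<in> O[at_infinity](\<lambda>x. \<bar>x\<bar> powr \<gamma>)"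
    by (simp add: O_space_def)
  then obtain c where "eventually (\<lambda>x. norm (cmod (Deriv k \<phi> x)) \<le> c * norm (\<bar>x\<bar> powr \<gamma>)) at_infinity"
    by (rule landau_o.bigE)
  then obtain r where r: "\<And>x. r \<le> \<bar>x\<bar> \<Longrightarrow> cmod (Deriv k \<phi> x) \<le> c * \<bar>x\<bar> powr \<gamma>"
    by (auto simp: eventually_at_infinity)
  define R where "R = max 2 r"
  have "isCont (Deriv k \<phi>) x" for x
    using sm by (simp add: smooth_def differentiable_imp_continuous_within)
  then have "compact (Deriv k \<phi> ` {-R..R})"
    by (intro compact_continuous_image) (auto simp: continuous_at_imp_continuous_on)
  then have "bounded (Deriv k \<phi> ` {-R..R})" by (rule compact_imp_bounded)
  then obtain B where B: "\<And>x. \<bar>x\<bar> \<le> R \<Longrightarrow> cmod (Deriv k \<phi> x) \<le> B"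
    by (fastforce simp: bounded_iff abs_le_iff)
  have "\<bar>0\<bar> \<le> R" by (simp add: R_def)
  then have B0: "0 \<le> B" using order_trans[OF norm_ge_zero B] by blast
  have "rho \<gamma> \<bar>x\<bar> * cmod (Deriv k \<phi> x) \<le> max c ((1 + R powr (- \<gamma>)) * B)" for x
  proof (cases "\<bar>x\<bar> \<le> R")
    case True
    have "rho \<gamma> \<bar>x\<bar> \<le> 1 + R powr (- \<gamma>)"
    proof (cases "\<gamma> \<ge> 0")
      case True
      have "rho \<gamma> \<bar>x\<bar> \<le> max 1 \<bar>x\<bar> powr 0"
        unfolding rho_altdef using True by (intro powr_mono) auto
      also have "\<dots> = 1" by (auto simp: max_def)
      finally show ?thesis using powr_ge_zero[of R "-\<gamma>"] by linarith
    next
      case False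
      have "rho \<gamma> \<bar>x\<bar> \<le> R powr (- \<gamma>)"
        unfolding rho_altdef using False \<open>\<bar>x\<bar> \<le> R\<close>
        by (intro powr_mono2) (auto simp: R_def)
      then show ?thesis by simp
    qed
    then have "rho \<gamma> \<bar>x\<bar> * cmod (Deriv k \<phi> x) \<le> (1 + R powr (- \<gamma>)) * B"
      using B[OF True] by (intro mult_mono) (auto intro: add_nonneg_nonneg)
    then show ?thesis by simp
  next
    case False
    then have x: "1 < \<bar>x\<bar>" "r \<le> \<bar>x\<bar>" by (auto simp: R_def)
    have "rho \<gamma> \<bar>x\<bar> * cmod (Deriv k \<phi> x) \<le> \<bar>x\<bar> powr (- \<gamma>) * (c * \<bar>x\<bar> powr \<gamma>)"
      using x r[of x] by (simp add: rho_def mult_left_mono)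
    also have "\<dots> = c" using x by (simp add: powr_minus field_simps)
    finally show ?thesis by simp
  qed
  then show "\<exists>M. \<forall>x. rho \<gamma> \<bar>x\<bar> * cmod (Deriv k \<phi> x) \<le> M" by blast
next
  assume *: "smooth \<phi> \<and> (\<forall>k. \<exists>M. \<forall>x. rho \<gamma> \<bar>x\<bar> * cmod (Deriv k \<phi> x) \<le> M)"
  have "(\<lambda>x. cmod (Deriv k \<phi> x)) \<in> O[at_infinity](\<lambda>x. \<bar>x\<bar> powr \<gamma>)" for k
  proof -
    obtain M where M: "\<And>x. rho \<gamma> \<bar>x\<bar> * cmod (Deriv k \<phi> x) \<le> M" using * by blast
    have "norm (cmod (Deriv k \<phi> x)) \<le> M * norm (\<bar>x\<bar> powr \<gamma>)" if "2 \<le> \<bar>x\<bar>" for x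
      using M[of x] that by (simp add: rho_def powr_minus field_simps)
    then show ?thesis
      by (intro bigoI[of _ M]) (auto simp: eventually_at_infinity)
  qed
  then show "\<phi> \<in> O_space \<gamma>" using * by (simp add: O_space_def)
qed

lemma O_spaceD:
  assumes "\<phi> \<in> O_space \<gamma>"
  shows "smooth \<phi>" and "\<exists>M. \<forall>x. rho \<gamma> \<bar>x\<bar> * cmod (Deriv k \<phi> x) \<le> M"
  using assms by (auto simp: O_space_iff)

lemma O_spaceI:
  assumes "D 0 = \<phi>"
    and "\<And>k x. (D k has_vector_derivative D (Suc k) x) (at x)"
    and "\<And>k. \<exists>M. \<forall>x. rho \<gamma> \<bar>x\<bar> * cmod (D k x) \<le> M"
  shows "\<phi> \<in> O_space \<gamma>"
  using assms(3) by (simp add: O_space_iff smoothI[of D, OF assms(1,2)] Deriv_eqI[of D, OF assms(1,2)])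

lemma Deriv_add:
  assumes "smooth \<phi>" "smooth \<eta>"
  shows "Deriv k (\<lambda>x. \<phi> x + \<eta> x) = (\<lambda>x. Deriv k \<phi> x + Deriv k \<eta> x)"
  by (rule Deriv_eqI[where D = "\<lambda>k x. Deriv k \<phi> x + Deriv k \<eta> x"])
    (auto simp: Deriv_0 intro!: has_vector_derivative_add smooth_has_vector_derivative assms)

lemma Deriv_cmult:
  assumes "smooth \<phi>"
  shows "Deriv k (\<lambda>x. c * \<phi> x) = (\<lambda>x. c * Deriv k \<phi> x)"
  by (rule Deriv_eqI[where D = "\<lambda>k x. c * Deriv k \<phi> x"])
    (auto simp: Deriv_0 intro!: has_vector_derivative_mult_right smooth_has_vector_derivative assms)

lemma O_space_add:
  assumes "\<phi> \<in> O_space \<gamma>" "\<eta> \<in> O_space \<gamma>"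
  shows "(\<lambda>x. \<phi> x + \<eta> x) \<in> O_space \<gamma>"
proof (rule O_spaceI[where D = "\<lambda>k x. Deriv k \<phi> x + Deriv k \<eta> x"])
  note sm = assms[THEN O_spaceD(1)]
  show "((\<lambda>x. Deriv k \<phi> x + Deriv k \<eta> x) has_vector_derivative
      Deriv (Suc k) \<phi> x + Deriv (Suc k) \<eta> x) (at x)" for k x
    by (intro has_vector_derivative_add smooth_has_vector_derivative sm)
  fix k
  obtain M where M: "\<And>x. rho \<gamma> \<bar>x\<bar> * cmod (Deriv k \<phi> x) \<le> M"
    using O_spaceD(2)[OF assms(1)] by blast
  obtain M' where M': "\<And>x. rho \<gamma> \<bar>x\<bar> * cmod (Deriv k \<eta> x) \<le> M'"
    using O_spaceD(2)[OF assms(2)] by blast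
  have "rho \<gamma> \<bar>x\<bar> * cmod (Deriv k \<phi> x + Deriv k \<eta> x) \<le> M + M'" for x
  proof -
    have "rho \<gamma> \<bar>x\<bar> * cmod (Deriv k \<phi> x + Deriv k \<eta> x)
        \<le> rho \<gamma> \<bar>x\<bar> * (cmod (Deriv k \<phi> x) + cmod (Deriv k \<eta> x))"
      by (intro mult_left_mono norm_triangle_ineq less_imp_le rho_pos)
    then show ?thesis using M[of x] M'[of x] by (simp add: distrib_left)
  qed
  then show "\<exists>M. \<forall>x. rho \<gamma> \<bar>x\<bar> * cmod (Deriv k \<phi> x + Deriv k \<eta> x) \<le> M" by blast
qed (simp add: Deriv_0)

lemma O_space_cmult:
  assumes "\<phi> \<in> O_space \<gamma>"
  shows "(\<lambda>x. c * \<phi> x) \<in> O_space \<gamma>"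
proof (rule O_spaceI[where D = "\<lambda>k x. c * Deriv k \<phi> x"])
  show "((\<lambda>x. c * Deriv k \<phi> x) has_vector_derivative c * Deriv (Suc k) \<phi> x) (at x)" for k x
    by (intro has_vector_derivative_mult_right smooth_has_vector_derivative O_spaceD(1)[OF assms])
  fix k
  obtain M where M: "\<And>x. rho \<gamma> \<bar>x\<bar> * cmod (Deriv k \<phi> x) \<le> M"
    using O_spaceD(2)[OF assms] by blast
  have "rho \<gamma> \<bar>x\<bar> * cmod (c * Deriv k \<phi> x) \<le> cmod c * M" for x
    using mult_left_mono[OF M[of x] norm_ge_zero[of c]] by (simp add: norm_mult mult_ac)
  then show "\<exists>M. \<forall>x. rho \<gamma> \<bar>x\<bar> * cmod (c * Deriv k \<phi> x) \<le> M" by blast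
qed (simp add: Deriv_0)

lemma O_space_0: "(\<lambda>x. 0) \<in> O_space \<gamma>"
  by (rule O_spaceI[where D = "\<lambda>k x. 0"]) auto

lemma has_vector_derivative_of_real_power:
  "((\<lambda>x. complex_of_real x ^ Suc i) has_vector_derivative of_nat (Suc i) * complex_of_real x ^ i) (at x)"
  by (rule has_vector_derivative_real_field[where f = "\<lambda>z. z ^ Suc i"])
    (rule DERIV_cong[OF DERIV_power[OF DERIV_ident]], simp)

lemma O_space_monomial:
  assumes "real j \<le> \<gamma>"
  shows "(\<lambda>x. complex_of_real x ^ j) \<in> O_space \<gamma>"
proof -
  define D where
    "D = (\<lambda>k x. if k \<le> j then fact j / fact (j - k) * complex_of_real x ^ (j - k) else 0)"
  show ?thesis
  proof (rule O_spaceI[where D = D])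
    show "D 0 = (\<lambda>x. complex_of_real x ^ j)" by (simp add: D_def)
    show "(D k has_vector_derivative D (Suc k) x) (at x)" for k x
    proof (cases "k < j")
      case True
      then obtain i where i: "j = Suc (k + i)" by (auto dest: less_imp_Suc_add)
      have "((\<lambda>x. fact j / fact (Suc i) * complex_of_real x ^ Suc i) has_vector_derivative
              fact j / fact i * complex_of_real x ^ i) (at x)"
        using has_vector_derivative_mult_right[OF has_vector_derivative_of_real_power[of i x],
            of "fact j / fact (Suc i)"]
        by (simp add: divide_simps del: of_nat_Suc power_Suc)
      then show ?thesis by (simp add: D_def i)
    next
      case False
      then show ?thesis by (cases "k = j") (auto simp: D_def)
    qed
    have "rho \<gamma> \<bar>x\<bar> * cmod (D k x) \<le> fact j" for k x
    proof (cases "k \<le> j")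
      case True
      have "rho \<gamma> \<bar>x\<bar> * \<bar>x\<bar> ^ (j - k) \<le> 1"
        using assms by (intro rho_power_le_1) auto
      moreover have "(fact j :: real) / fact (j - k) \<le> fact j"
        by (simp add: field_simps fact_ge_1)
      ultimately have "fact j / fact (j - k) * (rho \<gamma> \<bar>x\<bar> * \<bar>x\<bar> ^ (j - k)) \<le> fact j * 1"
        by (intro mult_mono) (auto simp: rho_pos less_imp_le)
      then show ?thesis
        using True by (simp add: D_def norm_mult norm_divide norm_power mult_ac)
    qed (simp add: D_def)
    then show "\<exists>M. \<forall>x. rho \<gamma> \<bar>x\<bar> * cmod (D k x) \<le> M" for k by blast
  qed
qed

section \<open>Continuous functionals\<close>

lemma O_seminorm_le:
  assumes "\<And>x. rho \<gamma> \<bar>x\<bar> * cmod (Deriv k \<phi> x) \<le> M"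
  shows "O_seminorm \<gamma> k \<phi> \<le> M"
  unfolding O_seminorm_def using assms by (intro cSUP_least) auto

lemma O_seminorm_ge:
  assumes "\<phi> \<in> O_space \<gamma>"
  shows "rho \<gamma> \<bar>x\<bar> * cmod (Deriv k \<phi> x) \<le> O_seminorm \<gamma> k \<phi>"
  unfolding O_seminorm_def
proof (intro cSUP_upper)
  show "bdd_above (range (\<lambda>x. rho \<gamma> \<bar>x\<bar> * cmod (Deriv k \<phi> x)))"
    using O_spaceD(2)[OF assms, of k] by (auto simp: bdd_above_def)
qed simp

text \<open>The generating balls have arbitrary centres, but one of radius \<open>r\<close> around \<open>\<phi>\<close> that contains 0
  also contains every function whose seminorm is less than \<open>r\<close> minus the seminorm of \<open>\<phi>\<close>; finite
  intersections then require finitely many such conditions. Bounding the derivatives pointwise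
  avoids suprema in the later estimates.\<close>

lemma O_topology_nhd_0:
  assumes "openin (O_topology \<gamma>) U" "(\<lambda>x. 0) \<in> U"
  shows "\<exists>K \<delta>. \<delta> > 0 \<and> (\<forall>\<eta>\<in>O_space \<gamma>.
           (\<forall>k\<le>K. \<forall>x. rho \<gamma> \<bar>x\<bar> * cmod (Deriv k \<eta> x) \<le> \<delta>) \<longrightarrow> \<eta> \<in> U)"
proof -
  have "generate_topology_on {{\<eta> \<in> O_space \<gamma>. O_seminorm \<gamma> \<alpha> (\<lambda>x. \<eta> x - \<phi> x) < r} | \<phi> \<alpha> r.
           \<phi> \<in> O_space \<gamma> \<and> 0 < r} U"
    using assms(1) by (simp add: O_topology_def openin_topology_generated_by_iff)
  then show ?thesis using assms(2)
  proof (induction rule: generate_topology_on.induct)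
    case Empty
    then show ?case by simp
  next
    case (Int A B)
    from Int obtain K \<delta> where A: "\<delta> > 0" "\<forall>\<eta>\<in>O_space \<gamma>.
        (\<forall>k\<le>K. \<forall>x. rho \<gamma> \<bar>x\<bar> * cmod (Deriv k \<eta> x) \<le> \<delta>) \<longrightarrow> \<eta> \<in> A" by blast
    from Int obtain K' \<delta>' where B: "\<delta>' > 0" "\<forall>\<eta>\<in>O_space \<gamma>.
        (\<forall>k\<le>K'. \<forall>x. rho \<gamma> \<bar>x\<bar> * cmod (Deriv k \<eta> x) \<le> \<delta>') \<longrightarrow> \<eta> \<in> B" by blast
    show ?case
      by (rule exI[of _ "max K K'"], rule exI[of _ "min \<delta> \<delta>'"]) (use A B in auto)
  next
    case (UN \<A>)
    then obtain A where "A \<in> \<A>" "(\<lambda>x. 0) \<in> A" by blast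
    with UN(2) show ?case by (meson UnionI)
  next
    case (Basis A)
    then obtain \<phi> \<alpha> r where A: "A = {\<eta> \<in> O_space \<gamma>. O_seminorm \<gamma> \<alpha> (\<lambda>x. \<eta> x - \<phi> x) < r}"
      and \<phi>: "\<phi> \<in> O_space \<gamma>" by blast
    define \<phi>' where "\<phi>' = (\<lambda>x. - 1 * \<phi> x)"
    have \<phi>': "\<phi>' \<in> O_space \<gamma>" unfolding \<phi>'_def by (rule O_space_cmult[OF \<phi>])
    define q where "q = O_seminorm \<gamma> \<alpha> \<phi>'"
    have q: "q < r" using Basis(2) by (simp add: A q_def \<phi>'_def)
    have "\<eta> \<in> A" if \<eta>: "\<eta> \<in> O_space \<gamma>"
      and small: "\<And>k x. k \<le> \<alpha> \<Longrightarrow> rho \<gamma> \<bar>x\<bar> * cmod (Deriv k \<eta> x) \<le> (r - q) / 2" for \<eta>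
    proof -
      have "O_seminorm \<gamma> \<alpha> (\<lambda>x. \<eta> x + \<phi>' x) \<le> (r - q) / 2 + q"
      proof (rule O_seminorm_le)
        fix x
        have "rho \<gamma> \<bar>x\<bar> * cmod (Deriv \<alpha> \<eta> x + Deriv \<alpha> \<phi>' x)
            \<le> rho \<gamma> \<bar>x\<bar> * (cmod (Deriv \<alpha> \<eta> x) + cmod (Deriv \<alpha> \<phi>' x))"
          by (intro mult_left_mono norm_triangle_ineq less_imp_le rho_pos)
        also have "\<dots> \<le> (r - q) / 2 + q"
          unfolding distrib_left q_def
          by (intro add_mono O_seminorm_ge[OF \<phi>'] small[unfolded q_def]) simp
        finally show "rho \<gamma> \<bar>x\<bar> * cmod (Deriv \<alpha> (\<lambda>x. \<eta> x + \<phi>' x) x) \<le> (r - q) / 2 + q"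
          by (simp add: Deriv_add O_spaceD(1)[OF \<eta>] O_spaceD(1)[OF \<phi>'])
      qed
      also have "\<dots> < r" using q by (simp add: field_simps)
      finally show ?thesis using \<eta> by (simp add: A \<phi>'_def)
    qed
    then show ?case using q by (intro exI[of _ \<alpha>] exI[of _ "(r - q) / 2"]) auto
  qed
qed

lemma openin_O_topology_preimage:
  assumes "f \<in> O_dual \<gamma>" "open V"
  shows "openin (O_topology \<gamma>) {\<phi> \<in> O_space \<gamma>. f \<phi> \<in> V}"
proof -
  have "\<phi> \<in> \<Union> {{\<eta> \<in> O_space \<gamma>. O_seminorm \<gamma> \<alpha> (\<lambda>x. \<eta> x - \<phi> x) < r} | \<phi> \<alpha> r.
           \<phi> \<in> O_space \<gamma> \<and> 0 < r}" if "\<phi> \<in> O_space \<gamma>" for \<phi>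
  proof -
    \<comment> \<open>every function lies in the unit ball around itself\<close>
    have "Deriv 0 (\<lambda>x. \<phi> x - \<phi> x) = (\<lambda>x. 0)" by (simp add: Deriv_0)
    then have "O_seminorm \<gamma> 0 (\<lambda>x. \<phi> x - \<phi> x) < 1" by (simp add: O_seminorm_def)
    with that have "\<phi> \<in> {\<eta> \<in> O_space \<gamma>. O_seminorm \<gamma> 0 (\<lambda>x. \<eta> x - \<phi> x) < 1}" by simp
    moreover have "\<dots> \<in> {{\<eta> \<in> O_space \<gamma>. O_seminorm \<gamma> \<alpha> (\<lambda>x. \<eta> x - \<phi> x) < r} | \<phi> \<alpha> r.
        \<phi> \<in> O_space \<gamma> \<and> 0 < r}" using that zero_less_one by blast
    ultimately show ?thesis by (rule UnionI[rotated])
  qed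
  then have "topspace (O_topology \<gamma>) = O_space \<gamma>"
    unfolding O_topology_def topology_generated_by_topspace by blast
  with assms show ?thesis
    using openin_continuous_map_preimage[of "O_topology \<gamma>" euclidean f V]
    by (simp add: O_dual_def)
qed

text \<open>Continuity at 0 together with homogeneity: rescale \<open>\<eta>\<close> so that it enters the neighbourhood of
  0 on which \<open>f\<close> is less than 1 in modulus.\<close>

lemma O_dual_bounded:
  assumes "f \<in> O_dual \<gamma>"
  shows "\<exists>K C. \<forall>\<eta>\<in>O_space \<gamma>. \<forall>M>0.
           (\<forall>k\<le>K. \<forall>x. rho \<gamma> \<bar>x\<bar> * cmod (Deriv k \<eta> x) \<le> M) \<longrightarrow> cmod (f \<eta>) \<le> C * M"
proof -
  have lin: "f (\<lambda>x. c * \<phi> x) = c * f \<phi>" if "\<phi> \<in> O_space \<gamma>" for c \<phi>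
    using assms that by (simp add: O_dual_def)
  have "f (\<lambda>x. 0) = 0" using lin[OF O_space_0, of 0] by simp
  then have "(\<lambda>x. 0) \<in> {\<phi> \<in> O_space \<gamma>. f \<phi> \<in> ball 0 1}" by (simp add: O_space_0)
  from O_topology_nhd_0[OF openin_O_topology_preimage[OF assms open_ball] this]
  obtain K \<delta> where \<delta>: "\<delta> > 0" and
    K: "\<And>\<eta>. \<eta> \<in> O_space \<gamma> \<Longrightarrow>
          (\<And>k x. k \<le> K \<Longrightarrow> rho \<gamma> \<bar>x\<bar> * cmod (Deriv k \<eta> x) \<le> \<delta>) \<Longrightarrow> cmod (f \<eta>) < 1"
    unfolding mem_Collect_eq mem_ball_0 by metis
  have "cmod (f \<eta>) \<le> 1 / \<delta> * M" if \<eta>: "\<eta> \<in> O_space \<gamma>" and M: "M > 0"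
    and le: "\<And>k x. k \<le> K \<Longrightarrow> rho \<gamma> \<bar>x\<bar> * cmod (Deriv k \<eta> x) \<le> M" for \<eta> M
  proof -
    define c where "c = complex_of_real (\<delta> / M)"
    have c: "cmod c = \<delta> / M" using M \<delta> by (simp add: c_def norm_divide)
    have "cmod (f (\<lambda>x. c * \<eta> x)) < 1"
    proof (rule K[OF O_space_cmult[OF \<eta>]])
      fix k x assume "k \<le> K"
      from mult_left_mono[OF le[OF this, of x], of "\<delta> / M"]
      show "rho \<gamma> \<bar>x\<bar> * cmod (Deriv k (\<lambda>x. c * \<eta> x) x) \<le> \<delta>"
        using M \<delta> by (simp add: Deriv_cmult[OF O_spaceD(1)[OF \<eta>]] norm_mult c mult_ac)
    qed
    then show ?thesis
      using M \<delta> by (simp add: lin[OF \<eta>] norm_mult c field_simps)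
  qed
  then show ?thesis by blast
qed

lemma O_dual_polynomial:
  assumes "f \<in> O_dual \<gamma>" "\<And>j. j < n \<Longrightarrow> real j \<le> \<gamma>"
  shows "(\<lambda>x. \<Sum>j<n. c j * complex_of_real x ^ j) \<in> O_space \<gamma> \<and>
         f (\<lambda>x. \<Sum>j<n. c j * complex_of_real x ^ j) = (\<Sum>j<n. c j * moment f j)"
  using assms(2)
proof (induction n)
  case 0
  have "\<forall>c. \<forall>\<phi>\<in>O_space \<gamma>. f (\<lambda>x. c * \<phi> x) = c * f \<phi>"
    using assms(1) by (simp add: O_dual_def)
  from bspec[OF spec[OF this, of 0] O_space_0] have "f (\<lambda>x. 0) = 0" by simp
  then show ?case by (simp add: O_space_0)
next
  case (Suc n)
  have mon: "(\<lambda>x. complex_of_real x ^ n) \<in> O_space \<gamma>"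
    using Suc.prems by (intro O_space_monomial) auto
  have IH: "(\<lambda>x. \<Sum>j<n. c j * complex_of_real x ^ j) \<in> O_space \<gamma>"
    "f (\<lambda>x. \<Sum>j<n. c j * complex_of_real x ^ j) = (\<Sum>j<n. c j * moment f j)"
    using Suc by auto
  have "f (\<lambda>x. (\<Sum>j<n. c j * complex_of_real x ^ j) + c n * complex_of_real x ^ n)
      = f (\<lambda>x. \<Sum>j<n. c j * complex_of_real x ^ j) + c n * f (\<lambda>x. complex_of_real x ^ n)"
    using assms(1) IH(1) mon O_space_cmult[OF mon, of "c n"] unfolding O_dual_def by simp
  then show ?case
    using O_space_add[OF IH(1) O_space_cmult[OF mon, of "c n"]] IH(2) by (simp add: moment_def)
qed

section \<open>The Taylor remainder\<close>

text \<open>The \<open>k\<close>-th derivative, in \<open>t\<close>, of the difference between \<open>\<psi>(s + t)\<close> and its Taylor polynomial of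
  degree less than \<open>n\<close> at \<open>s\<close>. Truncated subtraction in \<open>n - k\<close> is intended: from the \<open>n\<close>-th
  derivative on, nothing is left of the polynomial.\<close>

definition taylor_remainder :: "(real \<Rightarrow> complex) \<Rightarrow> nat \<Rightarrow> real \<Rightarrow> nat \<Rightarrow> real \<Rightarrow> complex" where
  "taylor_remainder \<psi> n s k t =
     Deriv k \<psi> (s + t) - (\<Sum>j<n - k. Deriv (k + j) \<psi> s / fact j * complex_of_real t ^ j)"

lemma has_vector_derivative_exp_poly:
  fixes c :: "nat \<Rightarrow> complex"
  shows "((\<lambda>t. \<Sum>j<Suc m. c j / fact j * complex_of_real t ^ j) has_vector_derivative
           (\<Sum>j<m. c (Suc j) / fact j * complex_of_real t ^ j)) (at t)"
proof -
  have mon: "((\<lambda>t. c (Suc j) / fact (Suc j) * complex_of_real t ^ Suc j) has_vector_derivative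
           c (Suc j) / fact j * complex_of_real t ^ j) (at t)" for j
    using has_vector_derivative_mult_right[OF has_vector_derivative_of_real_power[of j t],
        of "c (Suc j) / fact (Suc j)"]
    by (simp add: divide_simps del: of_nat_Suc power_Suc)
  have "((\<lambda>t. c 0 + (\<Sum>j<m. c (Suc j) / fact (Suc j) * complex_of_real t ^ Suc j))
          has_vector_derivative 0 + (\<Sum>j<m. c (Suc j) / fact j * complex_of_real t ^ j)) (at t)"
    by (intro has_vector_derivative_add has_vector_derivative_const has_vector_derivative_sum mon)
  then show ?thesis by (simp add: sum.lessThan_Suc_shift del: sum.lessThan_Suc fact_Suc power_Suc)
qed

lemma has_vector_derivative_taylor_remainder:
  assumes "smooth \<psi>"
  shows "(taylor_remainder \<psi> n s k has_vector_derivative taylor_remainder \<psi> n s (Suc k) t) (at t)"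
proof -
  have "((\<lambda>t. s + t) has_vector_derivative 0 + 1) (at t)"
    by (intro has_vector_derivative_add has_vector_derivative_const has_vector_derivative_id)
  from vector_diff_chain_at[OF this smooth_has_vector_derivative[OF assms]]
  have shift: "((\<lambda>t. Deriv k \<psi> (s + t)) has_vector_derivative Deriv (Suc k) \<psi> (s + t)) (at t)"
    by (simp add: o_def)
  show ?thesis
  proof (cases "k < n")
    case True
    then have "n - k = Suc (n - Suc k)" by simp
    with has_vector_derivative_diff[OF shift
        has_vector_derivative_exp_poly[of "\<lambda>j. Deriv (k + j) \<psi> s" "n - Suc k" t]]
    show ?thesis unfolding taylor_remainder_def by (simp del: sum.lessThan_Suc)
  next
    case False
    with shift show ?thesis unfolding taylor_remainder_def by simp
  qed
qed

lemma taylor_remainder_global: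
  assumes \<psi>: "\<psi> \<in> O_space \<gamma>" and n: "\<And>j. j < n \<Longrightarrow> real j \<le> \<gamma>" and B: "0 \<le> B"
  shows "\<exists>C. \<forall>s t. \<bar>s\<bar> \<le> B \<longrightarrow> rho \<gamma> \<bar>t\<bar> * cmod (taylor_remainder \<psi> n s k t) \<le> C"
proof -
  obtain M where M: "\<And>k x. rho \<gamma> \<bar>x\<bar> * cmod (Deriv k \<psi> x) \<le> M k"
    using O_spaceD(2)[OF \<psi>] by metis
  define L where "L = (1 + B) powr \<bar>\<gamma>\<bar>"
  have shifted: "rho \<gamma> \<bar>t\<bar> * cmod (Deriv k \<psi> (s + t)) \<le> L * M k" if "\<bar>s\<bar> \<le> B" for s t k
  proof -
    have "rho \<gamma> \<bar>t\<bar> * cmod (Deriv k \<psi> (s + t)) \<le> (L * rho \<gamma> \<bar>s + t\<bar>) * cmod (Deriv k \<psi> (s + t))"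
      unfolding L_def by (intro mult_right_mono rho_translate that) auto
    also have "\<dots> \<le> L * M k"
      using mult_left_mono[OF M[of "s + t" k], of L] by (simp add: L_def mult_ac)
    finally show ?thesis .
  qed
  have "rho \<gamma> \<bar>t\<bar> * cmod (taylor_remainder \<psi> n s k t) \<le> L * M k + (\<Sum>j<n - k. L * M (k + j))"
    if s: "\<bar>s\<bar> \<le> B" for s t
  proof -
    have coeff: "cmod (Deriv i \<psi> s) \<le> L * M i" for i
      using shifted[OF s, of 0 i] by (simp add: rho_def)
    have "rho \<gamma> \<bar>t\<bar> * cmod (\<Sum>j<n - k. Deriv (k + j) \<psi> s / fact j * complex_of_real t ^ j)
        \<le> rho \<gamma> \<bar>t\<bar> * (\<Sum>j<n - k. cmod (Deriv (k + j) \<psi> s / fact j * complex_of_real t ^ j))"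
      by (intro mult_left_mono norm_sum less_imp_le rho_pos)
    also have "\<dots> = (\<Sum>j<n - k. cmod (Deriv (k + j) \<psi> s) / fact j * (rho \<gamma> \<bar>t\<bar> * \<bar>t\<bar> ^ j))"
      by (simp add: sum_distrib_left norm_mult norm_divide norm_power mult_ac)
    also have "\<dots> \<le> (\<Sum>j<n - k. L * M (k + j) * 1)"
    proof (intro sum_mono mult_mono)
      fix j assume "j \<in> {..<n - k}"
      then show "rho \<gamma> \<bar>t\<bar> * \<bar>t\<bar> ^ j \<le> 1" using n by (intro rho_power_le_1) auto
      have "cmod (Deriv (k + j) \<psi> s) / fact j \<le> cmod (Deriv (k + j) \<psi> s) / 1"
        by (intro divide_left_mono fact_ge_1) auto
      with coeff[of "k + j"] show "cmod (Deriv (k + j) \<psi> s) / fact j \<le> L * M (k + j)" by simp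
      show "0 \<le> L * M (k + j)" using order_trans[OF norm_ge_zero coeff] .
      show "0 \<le> rho \<gamma> \<bar>t\<bar> * \<bar>t\<bar> ^ j" using rho_pos[of \<gamma> "\<bar>t\<bar>"] by simp
    qed
    finally have poly: "rho \<gamma> \<bar>t\<bar> * cmod (\<Sum>j<n - k. Deriv (k + j) \<psi> s / fact j * complex_of_real t ^ j)
        \<le> (\<Sum>j<n - k. L * M (k + j))" by simp
    have "rho \<gamma> \<bar>t\<bar> * cmod (taylor_remainder \<psi> n s k t)
        \<le> rho \<gamma> \<bar>t\<bar> * (cmod (Deriv k \<psi> (s + t))
            + cmod (\<Sum>j<n - k. Deriv (k + j) \<psi> s / fact j * complex_of_real t ^ j))"
      unfolding taylor_remainder_def by (intro mult_left_mono norm_triangle_ineq4 less_imp_le rho_pos)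
    with poly shifted[OF s, of t k] show ?thesis by (simp add: distrib_left)
  qed
  then show ?thesis by blast
qed

text \<open>Taylor's theorem, by downward induction on \<open>k\<close>: below order \<open>n\<close> the remainder vanishes at 0, so
  the mean value inequality turns a bound for the next derivative into one with one more power of
  \<open>\<bar>t\<bar>\<close>.\<close>

lemma taylor_remainder_local:
  assumes \<psi>: "\<psi> \<in> O_space \<gamma>" and n: "\<And>j. j < n \<Longrightarrow> real j \<le> \<gamma>" and B: "0 \<le> B"
  shows "\<exists>C. \<forall>s t. \<bar>s\<bar> \<le> B \<longrightarrow> \<bar>t\<bar> \<le> 1 \<longrightarrow>
           cmod (taylor_remainder \<psi> n s k t) \<le> C * \<bar>t\<bar> ^ (n - k)"
proof (induction "n - k" arbitrary: k)
  case 0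
  obtain C where C: "\<And>s t. \<bar>s\<bar> \<le> B \<Longrightarrow> rho \<gamma> \<bar>t\<bar> * cmod (taylor_remainder \<psi> n s k t) \<le> C"
    using taylor_remainder_global[OF \<psi> n B] by blast
  have "cmod (taylor_remainder \<psi> n s k t) \<le> C" if "\<bar>s\<bar> \<le> B" "\<bar>t\<bar> \<le> 1" for s t
    using C[of s t] that by (simp add: rho_def)
  then show ?case using 0 by auto
next
  case (Suc m)
  then have m: "m = n - Suc k" and nk: "n - k = Suc m" by auto
  obtain C where C: "\<And>s t. \<bar>s\<bar> \<le> B \<Longrightarrow> \<bar>t\<bar> \<le> 1 \<Longrightarrow>
      cmod (taylor_remainder \<psi> n s (Suc k) t) \<le> C * \<bar>t\<bar> ^ m"
    using Suc(1)[OF m] unfolding m by blast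
  have "cmod (taylor_remainder \<psi> n s k t) \<le> C * \<bar>t\<bar> ^ Suc m" if s: "\<bar>s\<bar> \<le> B" and t: "\<bar>t\<bar> \<le> 1" for s t
  proof -
    have C0: "0 \<le> C" using order_trans[OF norm_ge_zero C[OF s, of 1]] by simp
    have zero: "taylor_remainder \<psi> n s k 0 = 0"
      by (simp add: taylor_remainder_def nk sum.lessThan_Suc_shift del: sum.lessThan_Suc)
    have "norm (taylor_remainder \<psi> n s k t - taylor_remainder \<psi> n s k 0) \<le> (C * \<bar>t\<bar> ^ m) * norm (t - 0)"
    proof (rule differentiable_bound[where S = "closed_segment 0 t" and
          f' = "\<lambda>u h. h *\<^sub>R taylor_remainder \<psi> n s (Suc k) u"])
      show "(taylor_remainder \<psi> n s k has_derivative (\<lambda>h. h *\<^sub>R taylor_remainder \<psi> n s (Suc k) u))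
          (at u within closed_segment 0 t)" for u
        using has_vector_derivative_taylor_remainder[OF O_spaceD(1)[OF \<psi>], of n s k u]
        by (simp add: has_vector_derivative_def has_derivative_at_withinI)
      fix u assume "u \<in> closed_segment 0 t"
      then have u: "\<bar>u\<bar> \<le> \<bar>t\<bar>" by (auto simp: closed_segment_eq_real_ivl split: if_splits)
      have "cmod (taylor_remainder \<psi> n s (Suc k) u) \<le> C * \<bar>u\<bar> ^ m"
        using u t by (intro C s) auto
      also have "\<dots> \<le> C * \<bar>t\<bar> ^ m" using u C0 by (intro mult_left_mono power_mono) auto
      finally have le: "cmod (taylor_remainder \<psi> n s (Suc k) u) \<le> C * \<bar>t\<bar> ^ m" .
      have "norm (h *\<^sub>R taylor_remainder \<psi> n s (Suc k) u) \<le> C * \<bar>t\<bar> ^ m * norm h" for h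
        using mult_right_mono[OF le abs_ge_zero[of h]] by (simp add: mult.commute)
      then show "onorm (\<lambda>h. h *\<^sub>R taylor_remainder \<psi> n s (Suc k) u) \<le> C * \<bar>t\<bar> ^ m"
        by (rule onorm_le)
    qed auto
    then show ?thesis by (simp add: zero mult_ac)
  qed
  then show ?case unfolding nk by blast
qed

section \<open>Dilation\<close>

text \<open>In the region \<open>a \<le> \<bar>x\<bar>\<close> the growth bound is used and yields \<open>a powr (- \<gamma> - k)\<close>. For \<open>\<bar>x\<bar> \<le> a\<close>
  the local bound yields \<open>a powr (- k - m)\<close> times \<open>\<bar>x\<bar> ^ m\<close> with its weight, which is at most 1 if
  \<open>m \<le> \<gamma>\<close>, and at most \<open>a powr (- \<gamma>)\<close> if \<open>m = 0\<close> and \<open>\<gamma> < 0\<close>.\<close>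

lemma dilation_decay:
  assumes a: "1 \<le> a" and C: "0 \<le> C"
    and global: "\<And>t. rho \<gamma> \<bar>t\<bar> * cmod (g t) \<le> C"
    and local: "\<And>t. \<bar>t\<bar> \<le> 1 \<Longrightarrow> cmod (g t) \<le> C * \<bar>t\<bar> ^ m"
    and m: "m = 0 \<or> real m \<le> \<gamma>" and km: "q \<le> real k + real m" and q: "q \<le> \<gamma>"
  shows "rho \<gamma> \<bar>x\<bar> * (cmod (g (x / a)) / a ^ k) \<le> C * a powr (- q)"
proof (cases "\<bar>x\<bar> \<le> a")
  case True
  have "cmod (g (x / a)) \<le> C * \<bar>x / a\<bar> ^ m" using True a by (intro local) simp
  then have "rho \<gamma> \<bar>x\<bar> * (cmod (g (x / a)) / a ^ k) \<le> rho \<gamma> \<bar>x\<bar> * (C * \<bar>x / a\<bar> ^ m / a ^ k)"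
    using a less_imp_le[OF rho_pos, of \<gamma> "\<bar>x\<bar>"] by (intro mult_left_mono divide_right_mono) auto
  also have "\<dots> = C * ((rho \<gamma> \<bar>x\<bar> * \<bar>x\<bar> ^ m) * a powr (- (real k + real m)))"
  proof -
    have "a powr (- (real k + real m)) = 1 / (a ^ k * a ^ m)"
      using a by (simp only: powr_minus_divide powr_add) (simp add: powr_realpow)
    then show ?thesis using a by (simp add: power_divide mult_ac)
  qed
  also have "(rho \<gamma> \<bar>x\<bar> * \<bar>x\<bar> ^ m) * a powr (- (real k + real m)) \<le> a powr (- q)"
  proof (cases "real m \<le> \<gamma>")
    case True
    have "(rho \<gamma> \<bar>x\<bar> * \<bar>x\<bar> ^ m) * a powr (- (real k + real m)) \<le> 1 * a powr (- q)"
      using a km by (intro mult_mono rho_power_le_1 True powr_mono) auto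
    then show ?thesis by simp
  next
    case False
    with m have m0: "m = 0" "\<gamma> < 0" by auto
    have "rho \<gamma> \<bar>x\<bar> \<le> a powr (- \<gamma>)"
      unfolding rho_altdef using a m0 True by (intro powr_mono2) auto
    moreover have "a powr (- \<gamma>) \<le> a powr (- q)" using a q by (intro powr_mono) auto
    moreover have "a powr (- real k) \<le> a powr 0" using a by (intro powr_mono) auto
    ultimately have "rho \<gamma> \<bar>x\<bar> * a powr (- real k) \<le> a powr (- q) * 1"
      using a by (intro mult_mono) auto
    then show ?thesis by (simp add: m0)
  qed
  finally show ?thesis using C by (simp add: mult_left_mono)
next
  case False
  then have x: "a < \<bar>x\<bar>" "1 < \<bar>x\<bar>" "1 < \<bar>x / a\<bar>" using a by (auto simp: field_simps)
  have rho: "rho \<gamma> \<bar>x\<bar> = a powr (- \<gamma>) * rho \<gamma> \<bar>x / a\<bar>"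
    using x a by (simp add: rho_def powr_divide powr_minus field_simps)
  have "rho \<gamma> \<bar>x\<bar> * (cmod (g (x / a)) / a ^ k)
      = a powr (- \<gamma>) * (rho \<gamma> \<bar>x / a\<bar> * cmod (g (x / a))) * (1 / a ^ k)"
    by (simp add: rho)
  also have "\<dots> \<le> a powr (- q) * C * 1"
    using a q C rho_pos[of \<gamma> "\<bar>x / a\<bar>"]
    by (intro mult_mono global powr_mono) (auto simp: one_le_power)
  finally show ?thesis by (simp add: mult.commute)
qed

lemma has_vector_derivative_dilated_remainder:
  assumes "smooth \<psi>"
  shows "((\<lambda>x. taylor_remainder \<psi> n s k (x / a) / complex_of_real a ^ k) has_vector_derivative
           taylor_remainder \<psi> n s (Suc k) (x / a) / complex_of_real a ^ Suc k) (at x)"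
proof -
  have "((\<lambda>x. x / a) has_vector_derivative 1 / a) (at x)"
    by (auto intro!: derivative_eq_intros)
  from vector_diff_chain_at[OF this has_vector_derivative_taylor_remainder[OF assms]]
  have "((\<lambda>x. taylor_remainder \<psi> n s k (x / a)) has_vector_derivative
          (1 / a) *\<^sub>R taylor_remainder \<psi> n s (Suc k) (x / a)) (at x)"
    by (simp add: o_def)
  from has_vector_derivative_mult_right[OF this, of "1 / complex_of_real a ^ k"]
  show ?thesis by (simp add: scaleR_conv_of_real mult_ac)
qed

text \<open>The decay of all seminorms, hence of the values of \<open>f\<close>, on the dilated Taylor remainder. The
  constant is uniform in \<open>s\<close>, which makes it possible to let the base point \<open>s = -b/a\<close> depend on \<open>a\<close>.\<close>

lemma O_dual_dilated_remainder:
  assumes \<psi>: "\<psi> \<in> O_space \<gamma>" and f: "f \<in> O_dual \<gamma>" and B: "0 \<le> B"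
    and n_def: "n = nat \<lfloor>\<gamma>\<rfloor>"
  shows "\<exists>C. \<forall>a\<ge>1. \<forall>s. \<bar>s\<bar> \<le> B \<longrightarrow>
           (\<lambda>x. taylor_remainder \<psi> n s 0 (x / a)) \<in> O_space \<gamma> \<and>
           cmod (f (\<lambda>x. taylor_remainder \<psi> n s 0 (x / a))) \<le> C * a powr (- of_int \<lfloor>\<gamma>\<rfloor>)"
proof -
  note sm = O_spaceD(1)[OF \<psi>]
  have n: "real j \<le> \<gamma>" if "j < n" for j using that unfolding n_def by linarith
  have n': "n = 0 \<or> real n \<le> \<gamma>" unfolding n_def by linarith
  obtain C1 where C1: "\<And>k s t. \<bar>s\<bar> \<le> B \<Longrightarrow> rho \<gamma> \<bar>t\<bar> * cmod (taylor_remainder \<psi> n s k t) \<le> C1 k"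
    using taylor_remainder_global[OF \<psi> n B] by metis
  obtain C2 where C2: "\<And>k s t. \<bar>s\<bar> \<le> B \<Longrightarrow> \<bar>t\<bar> \<le> 1 \<Longrightarrow>
      cmod (taylor_remainder \<psi> n s k t) \<le> C2 k * \<bar>t\<bar> ^ (n - k)"
    using taylor_remainder_local[OF \<psi> n B] by metis
  define C where "C k = max 0 (max (C1 k) (C2 k))" for k
  define D where "D a s k x = taylor_remainder \<psi> n s k (x / a) / complex_of_real a ^ k" for a s k x
  have decay: "rho \<gamma> \<bar>x\<bar> * cmod (D a s k x) \<le> C k * a powr (- of_int \<lfloor>\<gamma>\<rfloor>)"
    if a: "1 \<le> a" and s: "\<bar>s\<bar> \<le> B" for a s k x
  proof -
    have "rho \<gamma> \<bar>x\<bar> * (cmod (taylor_remainder \<psi> n s k (x / a)) / a ^ k)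
        \<le> C k * a powr (- of_int \<lfloor>\<gamma>\<rfloor>)"
    proof (rule dilation_decay[OF a, where m = "n - k"])
      show "rho \<gamma> \<bar>t\<bar> * cmod (taylor_remainder \<psi> n s k t) \<le> C k" for t
        using C1[OF s, of t k] by (simp add: C_def)
      show "cmod (taylor_remainder \<psi> n s k t) \<le> C k * \<bar>t\<bar> ^ (n - k)" if "\<bar>t\<bar> \<le> 1" for t
        by (rule order_trans[OF C2[OF s that]]) (auto simp: C_def intro!: mult_right_mono)
      show "n - k = 0 \<or> real (n - k) \<le> \<gamma>" using n' by linarith
      show "of_int \<lfloor>\<gamma>\<rfloor> \<le> real k + real (n - k)" unfolding n_def by linarith
    qed (auto simp: C_def)
    then show ?thesis using a by (simp add: D_def norm_divide norm_power)
  qed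
  have D0: "D a s 0 = (\<lambda>x. taylor_remainder \<psi> n s 0 (x / a))" for a s
    by (rule ext) (simp add: D_def)
  have D': "(D a s k has_vector_derivative D a s (Suc k) x) (at x)" for a s k x
    using has_vector_derivative_dilated_remainder[OF sm] unfolding D_def by simp
  obtain K C' where C': "\<And>\<eta> M. \<eta> \<in> O_space \<gamma> \<Longrightarrow> M > 0 \<Longrightarrow>
      (\<And>k x. k \<le> K \<Longrightarrow> rho \<gamma> \<bar>x\<bar> * cmod (Deriv k \<eta> x) \<le> M) \<Longrightarrow> cmod (f \<eta>) \<le> C' * M"
    using O_dual_bounded[OF f] by metis
  \<comment> \<open>adding 1 makes the common bound strictly positive\<close>
  define M where "M = 1 + (\<Sum>k\<le>K. C k)"
  have C_nonneg: "0 \<le> C k" for k by (simp add: C_def)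
  have M_pos: "0 < M" unfolding M_def using sum_nonneg[of "{..K}" C] C_nonneg by (simp add: add_pos_nonneg)
  have C_le: "C k \<le> M" if "k \<le> K" for k
    using member_le_sum[of k "{..K}" C] that C_nonneg by (simp add: M_def)
  have "D a s 0 \<in> O_space \<gamma> \<and> cmod (f (D a s 0)) \<le> C' * M * a powr (- of_int \<lfloor>\<gamma>\<rfloor>)"
    if a: "1 \<le> a" and s: "\<bar>s\<bar> \<le> B" for a s
  proof
    show mem: "D a s 0 \<in> O_space \<gamma>"
      by (rule O_spaceI[where D = "D a s", OF refl D']) (use decay[OF a s] in blast)
    have "cmod (f (D a s 0)) \<le> C' * (M * a powr (- of_int \<lfloor>\<gamma>\<rfloor>))"
    proof (rule C'[OF mem])
      show "0 < M * a powr (- of_int \<lfloor>\<gamma>\<rfloor>)" using M_pos a by simp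
      fix k x assume "k \<le> K"
      have "rho \<gamma> \<bar>x\<bar> * cmod (D a s k x) \<le> C k * a powr (- of_int \<lfloor>\<gamma>\<rfloor>)" by (rule decay[OF a s])
      also have "\<dots> \<le> M * a powr (- of_int \<lfloor>\<gamma>\<rfloor>)" by (intro mult_right_mono C_le \<open>k \<le> K\<close>) simp
      finally show "rho \<gamma> \<bar>x\<bar> * cmod (Deriv k (D a s 0) x) \<le> M * a powr (- of_int \<lfloor>\<gamma>\<rfloor>)"
        by (simp add: Deriv_eqI[of "D a s", OF refl D'])
    qed
    then show "cmod (f (D a s 0)) \<le> C' * M * a powr (- of_int \<lfloor>\<gamma>\<rfloor>)" by (simp add: mult_ac)
  qed
  then show ?thesis unfolding D0 by blast
qed

section \<open>The asymptotic expansion\<close>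

lemma dilate_expansion:
  assumes f: "f \<in> O_dual \<gamma>" and n: "\<And>j. j < n \<Longrightarrow> real j \<le> \<gamma>" and a: "0 < a"
    and mem: "(\<lambda>x. taylor_remainder \<psi> n s 0 (x / a)) \<in> O_space \<gamma>"
  shows "complex_of_real (sqrt a) * dilate a f (\<lambda>x. \<psi> (x + s))
      - (\<Sum>j<n. moment f j * Deriv j \<psi> s / (fact j * complex_of_real (a powr (real j + 1 / 2))))
    = complex_of_real (a powr (- 1 / 2)) * f (\<lambda>x. taylor_remainder \<psi> n s 0 (x / a))"
proof -
  define c where "c j = Deriv j \<psi> s / fact j / complex_of_real a ^ j" for j
  let ?p = "\<lambda>x. \<Sum>j<n. c j * complex_of_real x ^ j"
  have p: "?p \<in> O_space \<gamma>" "f ?p = (\<Sum>j<n. c j * moment f j)"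
    using O_dual_polynomial[OF f n] by auto
  have "\<psi> (x / a + s) = taylor_remainder \<psi> n s 0 (x / a) + ?p x" for x
    by (simp add: taylor_remainder_def c_def Deriv_0 power_divide add.commute)
  then have split: "f (\<lambda>x. \<psi> (x / a + s))
      = f (\<lambda>x. taylor_remainder \<psi> n s 0 (x / a)) + (\<Sum>j<n. c j * moment f j)"
    using f mem p unfolding O_dual_def by simp
  have "sqrt a * (1 / a) = a powr (- 1 / 2)"
  proof -
    have "a powr (1 / 2 - 1) = sqrt a / a"
      using a by (simp only: powr_diff powr_half_sqrt less_imp_le powr_one)
    then show ?thesis by simp
  qed
  then have root: "complex_of_real (sqrt a) * complex_of_real (1 / a) = complex_of_real (a powr (- 1 / 2))"
    by (metis of_real_mult)
  have term_eq: "moment f j * Deriv j \<psi> s / (fact j * complex_of_real (a powr (real j + 1 / 2)))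
      = complex_of_real (a powr (- 1 / 2)) * (c j * moment f j)" for j
  proof -
    have "a powr (real j + 1 / 2) = a ^ j / a powr (- 1 / 2)"
      using a powr_diff[of a "real j" "- 1 / 2"] by (simp add: powr_realpow)
    then show ?thesis by (simp add: c_def)
  qed
  have "complex_of_real (sqrt a) * dilate a f (\<lambda>x. \<psi> (x + s))
      = complex_of_real (a powr (- 1 / 2)) * f (\<lambda>x. \<psi> (x / a + s))"
    by (simp only: dilate_def root flip: mult.assoc)
  then show ?thesis
    by (simp add: split term_eq distrib_left sum_distrib_left)
qed

theorem theorem4p1:
  fixes \<gamma> b :: real and N :: int
    and \<psi> :: "real \<Rightarrow> complex" and f :: "(real \<Rightarrow> complex) \<Rightarrow> complex"
    and \<mu> :: "nat \<Rightarrow> complex"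
  assumes "\<psi> \<in> O_space \<gamma>"
    and "f \<in> O_dual \<gamma>"
    and "N = \<lfloor>\<gamma>\<rfloor> - 1"
    and "\<mu> = moment f"
  shows "(\<lambda>a. complex_of_real (sqrt a) * dilate a f (\<lambda>x. \<psi> (x - b / a))
            - (\<Sum>\<alpha> | int \<alpha> \<le> N. \<mu> \<alpha> * Deriv \<alpha> \<psi> (- b / a)
                  / (fact \<alpha> * complex_of_real (a powr (real \<alpha> + 1 / 2)))))
         \<in> O[at_top](\<lambda>a::real. complex_of_real (1 / a powr (of_int N + 1 / 2)))"
proof -
  define n where "n = nat \<lfloor>\<gamma>\<rfloor>"
  have n: "real j \<le> \<gamma>" if "j < n" for j using that unfolding n_def by linarith
  have range: "{\<alpha>. int \<alpha> \<le> N} = {..<n}" using assms(3) by (auto simp: n_def)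
  obtain C where C: "\<And>a s. 1 \<le> a \<Longrightarrow> \<bar>s\<bar> \<le> \<bar>b\<bar> \<Longrightarrow>
      (\<lambda>x. taylor_remainder \<psi> n s 0 (x / a)) \<in> O_space \<gamma> \<and>
      cmod (f (\<lambda>x. taylor_remainder \<psi> n s 0 (x / a))) \<le> C * a powr (- of_int \<lfloor>\<gamma>\<rfloor>)"
    using O_dual_dilated_remainder[OF assms(1,2) abs_ge_zero n_def] by blast
  have C0: "0 \<le> C" using order_trans[OF norm_ge_zero conjunct2[OF C[of 1 0]]] by simp
  show ?thesis
  proof (rule bigoI[of _ C], rule eventually_mono[OF eventually_ge_at_top[of "1 :: real"]])
    fix a :: real assume a: "1 \<le> a"
    define s where "s = - b / a"
    have "\<bar>b\<bar> * 1 \<le> \<bar>b\<bar> * a" using a by (intro mult_left_mono) auto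
    then have s: "\<bar>s\<bar> \<le> \<bar>b\<bar>" using a by (simp add: s_def field_simps)
    let ?R = "f (\<lambda>x. taylor_remainder \<psi> n s 0 (x / a))"
    have "complex_of_real (sqrt a) * dilate a f (\<lambda>x. \<psi> (x - b / a))
            - (\<Sum>\<alpha> | int \<alpha> \<le> N. \<mu> \<alpha> * Deriv \<alpha> \<psi> (- b / a)
                  / (fact \<alpha> * complex_of_real (a powr (real \<alpha> + 1 / 2))))
        = complex_of_real (a powr (- 1 / 2)) * ?R"
      using dilate_expansion[OF assms(2) n _ conjunct1[OF C[OF a s]]] a
      by (simp add: range assms(4) s_def)
    moreover have "cmod (complex_of_real (a powr (- 1 / 2)) * ?R) \<le> C * a powr (- (of_int N + 1 / 2))"
    proof -
      have "cmod (complex_of_real (a powr (- 1 / 2)) * ?R)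
          \<le> a powr (- 1 / 2) * (C * a powr (- of_int \<lfloor>\<gamma>\<rfloor>))"
        using conjunct2[OF C[OF a s]] by (simp add: norm_mult mult_left_mono)
      also have "\<dots> = C * a powr (- of_int \<lfloor>\<gamma>\<rfloor> - 1 / 2)"
        by (simp add: add.commute flip: powr_add)
      also have "\<dots> \<le> C * a powr (- (of_int N + 1 / 2))"
        using a C0 assms(3) by (intro mult_left_mono powr_mono) auto
      finally show ?thesis .
    qed
    moreover have "norm (complex_of_real (1 / a powr (of_int N + 1 / 2))) = a powr (- (of_int N + 1 / 2))"
      unfolding powr_minus_divide norm_of_real by (rule abs_of_nonneg) simp
    ultimately show "norm (complex_of_real (sqrt a) * dilate a f (\<lambda>x. \<psi> (x - b / a))
            - (\<Sum>\<alpha> | int \<alpha> \<le> N. \<mu> \<alpha> * Deriv \<alpha> \<psi> (- b / a)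
                  / (fact \<alpha> * complex_of_real (a powr (real \<alpha> + 1 / 2)))))
        \<le> C * norm (complex_of_real (1 / a powr (of_int N + 1 / 2)))"
      by (simp only:)
  qed
qed

end
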